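(* Let $H$ be a separable Hilbert space and let $\{\chi_n\}_{n\in\mathbb{N}}$ be an orthonormal system of vectors in $H$. Then for every $\epsilon>0$ there exists an orthonormal basis $\{\psi_n\}_{n\in\mathbb{N}}$ of $H$ such that $$\|\psi_n-\chi_n\|\to 0 \quad\text{as } n\to\infty,$$ and, in addition, $\|\psi_n-\chi_n\|<\epsilon$ for all $n\in\mathbb{N}$.
   Context: An orthonormal system $\{\chi_n\}_{n\in\mathbb{N}}$ is an infinite sequence of vectors with $\langle\chi_n,\chi_m\rangle=\delta_{nm}$; it is not assumed to be complete. An orthonormal basis of $H$ is an orthonormal system whose linear span is dense in $H$ (a complete orthonormal system). *)

theory Defs
  imports "HOL-Analysis.Analysis"
begin

text \<open>Hilbert spaces are treated over the real and the complex numbers at once.  The class below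
  is satisfied by these two fields only, up to isomorphism: its axioms imply that \<open>z + conj z\<close> is
  real, so that every \<open>z\<close> is a root of the real quadratic \<open>X\<^sup>2 - (z + conj z) X + (norm z)\<^sup>2\<close>.\<close>

class real_or_complex_field = real_normed_field +
  fixes conj :: "'a \<Rightarrow> 'a"
  assumes conj_add: "conj (z + w) = conj z + conj w"
    and conj_mult: "conj (z * w) = conj z * conj w"
    and conj_conj: "conj (conj z) = z"
    and mult_conj: "z * conj z = (norm z)\<^sup>2 *\<^sub>R 1"

instantiation real :: real_or_complex_field
begin
definition "conj (z::real) = z"
instance by standard (auto simp: conj_real_def power2_eq_square)
end

instantiation complex :: real_or_complex_field
begin
definition "conj (z::complex) = cnj z"
instance by standard (simp_all add: conj_complex_def scaleR_conv_of_real complex_norm_square del: of_real_power)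
end

text \<open>The norm, topology and completeness of the space come from its type; the last axiom says that
  this norm is the one induced by the inner product.  The inner product is linear in its first
  argument.\<close>

locale hilbert_space = vector_space smul
  for smul :: "'k::real_or_complex_field \<Rightarrow> 'a::{real_normed_vector, complete_space} \<Rightarrow> 'a" +
  fixes ip :: "'a \<Rightarrow> 'a \<Rightarrow> 'k"
  assumes smul_of_real: "smul (of_real r) x = r *\<^sub>R x"
    and ip_add_left: "ip (x + y) z = ip x z + ip y z"
    and ip_smul_left: "ip (smul c x) y = c * ip x y"
    and ip_commute: "ip x y = conj (ip y x)"
    and ip_self: "ip x x = of_real ((norm x)\<^sup>2)"

lemma hilbert_space_real:
  "hilbert_space (scaleR :: real \<Rightarrow> 'a::{real_inner, complete_space} \<Rightarrow> 'a) inner"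
  by unfold_locales
    (auto simp: conj_real_def inner_add_left inner_commute power2_norm_eq_inner algebra_simps)

lemma hilbert_space_complex:
  "hilbert_space ((*) :: complex \<Rightarrow> complex \<Rightarrow> complex) (\<lambda>z w. z * cnj w)"
  by unfold_locales
    (simp_all add: conj_complex_def scaleR_conv_of_real complex_norm_square algebra_simps del: of_real_power)

definition orthonormal_system :: "('a \<Rightarrow> 'a \<Rightarrow> 'k::zero_neq_one) \<Rightarrow> (nat \<Rightarrow> 'a) \<Rightarrow> bool" where
  "orthonormal_system ip \<phi> \<longleftrightarrow> (\<forall>n m. ip (\<phi> n) (\<phi> m) = (if n = m then 1 else 0))"

definition orthonormal_basis ::
  "('k::field \<Rightarrow> 'a::{ab_group_add, topological_space} \<Rightarrow> 'a) \<Rightarrow> ('a \<Rightarrow> 'a \<Rightarrow> 'k) \<Rightarrow> (nat \<Rightarrow> 'a) \<Rightarrow> bool"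
  where "orthonormal_basis smul ip \<psi> \<longleftrightarrow>
    orthonormal_system ip \<psi> \<and> closure (module.span smul (range \<psi>)) = UNIV"

end

theory Submission
  imports Defs
begin

text \<open>If \<open>e\<close> is a unit vector orthogonal to \<open>\<chi>\<^sub>1, \<dots>, \<chi>\<^sub>N\<close> and \<open>w = (\<chi>\<^sub>1 + \<dots> + \<chi>\<^sub>N) / sqrt N\<close>, then the
  rotation of the plane of \<open>w\<close> and \<open>e\<close> that takes \<open>w\<close> to \<open>e\<close> moves each \<open>\<chi>\<^sub>i\<close> to
  \<open>\<psi>\<^sub>i = \<chi>\<^sub>i + (e - w) / sqrt N\<close>, at distance at most \<open>2 / sqrt N\<close>.  The span of \<open>\<psi>\<^sub>1, \<dots>, \<psi>\<^sub>N\<close> contains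
  \<open>e\<close>, and \<open>w\<close> is now the vector which it misses.  Partition the given system into finite blocks of
  sizes tending to infinity, and let each block absorb one vector: either a member of an orthonormal
  basis of the complement of the system or the vector \<open>w\<close> left over from an earlier block.  If every
  such vector is absorbed exactly once, the span of the \<open>\<psi>\<^sub>n\<close> contains the original system and the
  basis of its complement.\<close>

section \<open>Inner products\<close>

text \<open>By \<open>mult_conj\<close>, \<open>r\<close> times its conjugate is the square of
  \<open>r\<close>, and a nonzero \<open>r\<close> cancels; for \<open>r = 0\<close> additivity is
  used instead.\<close>

lemma conj_of_real: "conj (of_real r :: 'k::real_or_complex_field) = of_real r"
proof (cases "r = 0")
  case True
  have "conj 0 = (0::'k)"
    using conj_add[of "0::'k" 0] by simp
  with True show ?thesis by simp
next
  case False
  have "of_real r * conj (of_real r) = (of_real r * of_real r :: 'k)"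
    by (simp add: mult_conj scaleR_conv_of_real power2_eq_square)
  with False show ?thesis by simp
qed

lemma conj_0 [simp]: "conj (0::'k::real_or_complex_field) = 0"
  using conj_of_real[of 0] by simp

context hilbert_space
begin

lemma ip_0_left [simp]: "ip 0 y = 0"
  using ip_add_left[of 0 0 y] by simp

lemma ip_0_right [simp]: "ip x 0 = 0"
  using ip_commute[of x 0] by simp

lemma ip_diff_left: "ip (x - y) z = ip x z - ip y z"
  using ip_add_left[of "x - y" y z] by (simp add: algebra_simps)

lemma ip_add_right: "ip x (y + z) = ip x y + ip x z"
  by (metis ip_commute ip_add_left conj_add)

lemma ip_diff_right: "ip x (y - z) = ip x y - ip x z"
  using ip_add_right[of x "y - z" z] by (simp add: algebra_simps)

lemma ip_smul_right: "ip x (smul c y) = conj c * ip x y"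
  by (metis ip_commute ip_smul_left conj_mult)

lemma ip_scaleR_left: "ip (r *\<^sub>R x) y = of_real r * ip x y"
  by (metis smul_of_real ip_smul_left)

lemma ip_scaleR_right: "ip x (r *\<^sub>R y) = of_real r * ip x y"
  by (metis smul_of_real ip_smul_right conj_of_real)

lemma ip_sum_left: "ip (\<Sum>i\<in>A. f i) y = (\<Sum>i\<in>A. ip (f i) y)"
  by (induction A rule: infinite_finite_induct) (auto simp: ip_add_left)

lemma ip_sum_right: "ip y (\<Sum>i\<in>A. f i) = (\<Sum>i\<in>A. ip y (f i))"
  by (induction A rule: infinite_finite_induct) (auto simp: ip_add_right)

lemma ip_eq_0_commute: "ip x y = 0 \<longleftrightarrow> ip y x = 0"
  by (metis ip_commute conj_0)

lemma ip_self_unit: "norm x = 1 \<Longrightarrow> ip x x = 1"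
  by (simp add: ip_self)

lemma norm_eq_1_if_ip_self: "ip x x = 1 \<Longrightarrow> norm x = 1"
  by (metis ip_self of_real_eq_1_iff norm_ge_zero power2_eq_1_iff zero_le_one le_minus_one_simps(3))

lemma pythagoras:
  assumes "ip x y = 0"
  shows "(norm (x + y))\<^sup>2 = (norm x)\<^sup>2 + (norm y)\<^sup>2"
proof -
  have "of_real ((norm (x + y))\<^sup>2) = (of_real ((norm x)\<^sup>2 + (norm y)\<^sup>2) :: 'k)"
    using assms ip_eq_0_commute[of x y] unfolding of_real_add ip_self[symmetric]
    by (simp add: ip_add_left ip_add_right)
  then show ?thesis
    using of_real_eq_iff by blast
qed

lemma norm_smul: "norm (smul c x) = norm c * norm x"
proof -
  have "of_real ((norm (smul c x))\<^sup>2) = (c * conj c) * ip x x"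
    unfolding ip_self[symmetric] by (simp add: ip_smul_left ip_smul_right mult_ac)
  also have "\<dots> = of_real ((norm c * norm x)\<^sup>2)"
    by (simp add: mult_conj ip_self scaleR_conv_of_real power_mult_distrib)
  finally have "(norm (smul c x))\<^sup>2 = (norm c * norm x)\<^sup>2"
    using of_real_eq_iff by blast
  then show ?thesis by simp
qed

lemma span_scaleR: "x \<in> span S \<Longrightarrow> r *\<^sub>R x \<in> span S"
  using span_scale[of x S "of_real r"] by (simp add: smul_of_real)

section \<open>Projection onto the closed span of an orthonormal system\<close>

lemma norm_orthonormal_combination:
  assumes "orthonormal_system ip u" "finite A"
  shows "(norm (\<Sum>n\<in>A. smul (c n) (u n)))\<^sup>2 = (\<Sum>n\<in>A. (norm (c n))\<^sup>2)"
  using \<open>finite A\<close>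
proof (induction rule: finite_induct)
  case (insert m A)
  have "ip (smul (c m) (u m)) (\<Sum>n\<in>A. smul (c n) (u n)) = 0"
    unfolding ip_sum_right ip_smul_left ip_smul_right
    using insert.hyps assms(1) by (intro sum.neutral) (auto simp: orthonormal_system_def)
  moreover have "norm (u m) = 1"
    using assms(1) by (auto simp: orthonormal_system_def intro: norm_eq_1_if_ip_self)
  ultimately show ?case
    using insert by (simp add: pythagoras norm_smul)
qed simp

lemma ip_diff_fourier:
  assumes "orthonormal_system ip u" "finite A" "m \<in> A"
  shows "ip (d - (\<Sum>n\<in>A. smul (ip d (u n)) (u n))) (u m) = 0"
proof -
  have "(\<Sum>n\<in>A. ip d (u n) * ip (u n) (u m)) = (\<Sum>n\<in>A. if n = m then ip d (u m) else 0)"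
    using assms(1) by (intro sum.cong) (auto simp: orthonormal_system_def)
  with assms(2,3) show ?thesis
    by (simp add: ip_diff_left ip_sum_left ip_smul_left)
qed

lemma bessel:
  assumes "orthonormal_system ip u" "finite A"
  shows "(\<Sum>n\<in>A. (norm (ip d (u n)))\<^sup>2) \<le> (norm d)\<^sup>2"
proof -
  define s where "s = (\<Sum>n\<in>A. smul (ip d (u n)) (u n))"
  \<comment> \<open>The residual \<open>d - s\<close> is orthogonal to every \<open>u n\<close> with
    \<open>n\<close> in \<open>A\<close>, hence to \<open>s\<close>, so Pythagoras applies.\<close>
  have "ip (d - s) s = (\<Sum>n\<in>A. conj (ip d (u n)) * ip (d - s) (u n))"
    by (subst (2) s_def) (simp add: ip_sum_right ip_smul_right)
  also have "\<dots> = 0"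
    unfolding s_def using ip_diff_fourier[OF assms] by (intro sum.neutral) auto
  finally have "(norm d)\<^sup>2 = (norm (d - s))\<^sup>2 + (norm s)\<^sup>2"
    using pythagoras[of "d - s" s] by simp
  then show ?thesis
    using norm_orthonormal_combination[OF assms, of "\<lambda>n. ip d (u n)"] by (simp add: s_def)
qed

text \<open>Pythagoras turns squared distances between partial sums into distances between partial
  sums of the Bessel series; the Cauchy property carries over and completeness gives the
  limit.\<close>

lemma fourier_series_convergent:
  assumes "orthonormal_system ip u"
  shows "convergent (\<lambda>N. \<Sum>n<N. smul (ip d (u n)) (u n))"
proof -
  let ?s = "\<lambda>N. \<Sum>n<N. smul (ip d (u n)) (u n)" and ?q = "\<lambda>n. (norm (ip d (u n)))\<^sup>2"
  have "summable ?q"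
    using bessel[OF assms] by (intro summableI_nonneg_bounded[where x = "(norm d)\<^sup>2"]) auto
  then have cauchy: "Cauchy (\<lambda>N. \<Sum>n<N. ?q n)"
    by (simp add: summable_iff_convergent Cauchy_convergent_iff)
  have dist: "(norm (?s N - ?s M))\<^sup>2 = \<bar>(\<Sum>n<N. ?q n) - (\<Sum>n<M. ?q n)\<bar>" if "M \<le> N" for M N
  proof -
    have *: "(\<Sum>n<N. f n) - (\<Sum>n<M. f n) = (\<Sum>n\<in>{M..<N}. f n)" for f :: "nat \<Rightarrow> 'b::ab_group_add"
      using sum_diff_nat_ivl[of 0 M N f] that by (simp add: lessThan_atLeast0)
    show ?thesis
      unfolding * using norm_orthonormal_combination[OF assms] by (simp add: sum_nonneg)
  qed
  have "Cauchy ?s"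
  proof (rule metric_CauchyI)
    fix r :: real assume "r > 0"
    then obtain K where K: "\<And>m n. m \<ge> K \<Longrightarrow> n \<ge> K \<Longrightarrow> dist (\<Sum>i<m. ?q i) (\<Sum>i<n. ?q i) < r\<^sup>2"
      using metric_CauchyD[OF cauchy, of "r\<^sup>2"] by auto
    have less: "norm (?s n - ?s m) < r" if "K \<le> m" "m \<le> n" for m n
      using K[of n m] dist[of m n] that \<open>r > 0\<close>
      by (intro power2_less_imp_less[of _ r]) (auto simp: dist_real_def)
    show "\<exists>K. \<forall>m\<ge>K. \<forall>n\<ge>K. dist (?s m) (?s n) < r"
    proof (intro exI allI impI)
      fix m n assume "K \<le> m" "K \<le> n"
      then show "dist (?s m) (?s n) < r"
        using less[of m n] less[of n m] by (cases "m \<le> n") (auto simp: dist_norm norm_minus_commute)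
    qed
  qed
  then show ?thesis
    by (rule Cauchy_convergent)
qed

lemma orthogonal_projection_exists:
  assumes u: "orthonormal_system ip u"
  obtains p where "p \<in> closure (span (range u))" "\<And>n. ip (d - p) (u n) = 0"
proof -
  let ?s = "\<lambda>N. \<Sum>n<N. smul (ip d (u n)) (u n)"
  obtain p where p: "?s \<longlonglongrightarrow> p"
    using fourier_series_convergent[OF u] by (auto simp: convergent_def)
  have "?s N \<in> span (range u)" for N
    by (intro span_sum span_scale span_base) auto
  then have "p \<in> closure (span (range u))"
    using p unfolding closure_sequential by (intro exI[of _ ?s]) auto
  moreover have "ip (d - p) (u m) = 0" for m
  proof -
    \<comment> \<open>Bessel's inequality for one vector supplies the continuity of
      \<open>ip\<close> in its first argument needed to pass to the limit.\<close>
    have bound: "norm (ip x (u m)) \<le> norm x" for x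
      using bessel[OF u, of "{m}" x] by (simp add: abs_le_square_iff[symmetric])
    have "norm (ip (d - p) (u m)) \<le> norm (?s N - p)" if "N > m" for N
    proof -
      have "ip (d - p) (u m) = ip (d - ?s N) (u m) + ip (?s N - p) (u m)"
        by (simp add: ip_add_left[symmetric])
      also have "\<dots> = ip (?s N - p) (u m)"
        using ip_diff_fourier[OF u, of "{..<N}" m d] that by simp
      finally show ?thesis
        using bound by simp
    qed
    then have "\<forall>\<^sub>F N in sequentially. norm (ip (d - p) (u m)) \<le> norm (?s N - p)"
      using eventually_gt_at_top by (rule eventually_mono[rotated])
    moreover have "(\<lambda>N. norm (?s N - p)) \<longlonglongrightarrow> 0"
      using p by (simp add: LIM_zero tendsto_norm_zero)
    ultimately have "norm (ip (d - p) (u m)) \<le> 0"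
      by (intro tendsto_lowerbound) auto
    then show ?thesis by simp
  qed
  ultimately show ?thesis
    using that by blast
qed

section \<open>Gram--Schmidt\<close>

text \<open>Since \<open>sgn 0 = 0\<close>, linearly dependent entries produce zero vectors.\<close>

fun gram_schmidt :: "(nat \<Rightarrow> 'a) \<Rightarrow> nat \<Rightarrow> 'a" where
  "gram_schmidt r k =
    sgn (r k - (\<Sum>i<k. smul (ip (r k) (gram_schmidt r i)) (gram_schmidt r i)))"

declare gram_schmidt.simps [simp del]

lemma ip_sgn_left: "ip (sgn x) y = of_real (inverse (norm x)) * ip x y"
  by (simp add: sgn_div_norm ip_scaleR_left)

lemma ip_gram_schmidt_self:
  "ip (gram_schmidt r k) (gram_schmidt r k) = (if gram_schmidt r k = 0 then 0 else 1)"
proof -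
  have "norm (sgn x) = 1" if "sgn x \<noteq> 0" for x :: 'a
    using that by (simp add: norm_sgn sgn_zero_iff)
  then show ?thesis
    by (metis gram_schmidt.simps ip_self_unit ip_0_left)
qed

lemma ip_gram_schmidt_less:
  "j < k \<Longrightarrow> ip (gram_schmidt r k) (gram_schmidt r j) = 0"
proof (induction k arbitrary: j rule: less_induct)
  case (less k)
  let ?e = "gram_schmidt r"
  have ne: "ip (?e i) (?e j) = 0" if "i < k" "i \<noteq> j" for i
    using less that by (metis ip_eq_0_commute linorder_neqE_nat)
  \<comment> \<open>If \<open>?e j = 0\<close>, the term at \<open>i = j\<close> vanishes on both
    sides, so the missing normalisation does no harm.\<close>
  have "(\<Sum>i<k. ip (r k) (?e i) * ip (?e i) (?e j)) = (\<Sum>i<k. if i = j then ip (r k) (?e j) else 0)"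
    using ne by (intro sum.cong) (auto simp: ip_gram_schmidt_self)
  with \<open>j < k\<close> show ?case
    by (subst gram_schmidt.simps) (simp add: ip_sgn_left ip_diff_left ip_sum_left ip_smul_left)
qed

lemma ip_gram_schmidt:
  "ip (gram_schmidt r i) (gram_schmidt r j) = (if i = j \<and> gram_schmidt r i \<noteq> 0 then 1 else 0)"
  using ip_gram_schmidt_less ip_gram_schmidt_self ip_eq_0_commute
  by (metis linorder_neqE_nat)

lemma ip_gram_schmidt_eq_0:
  assumes "\<And>k. ip (r k) x = 0"
  shows "ip (gram_schmidt r k) x = 0"
proof (induction k rule: less_induct)
  case (less k)
  then show ?case
    by (subst gram_schmidt.simps) (simp add: assms ip_sgn_left ip_diff_left ip_sum_left ip_smul_left)
qed

lemma in_span_gram_schmidt: "r k \<in> span (range (gram_schmidt r))"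
proof -
  let ?e = "gram_schmidt r"
  define t where "t = (\<Sum>i<k. smul (ip (r k) (?e i)) (?e i))"
  have "?e k = sgn (r k - t)"
    by (subst gram_schmidt.simps) (simp add: t_def)
  \<comment> \<open>For \<open>r k = t\<close> the coefficient is 0, so the identity survives the
    convention \<open>sgn 0 = 0\<close>.\<close>
  then have "r k = norm (r k - t) *\<^sub>R ?e k + t"
    by (cases "r k = t") (simp_all add: sgn_div_norm)
  moreover have "t \<in> span (range ?e)"
    unfolding t_def by (intro span_sum span_scale span_base) auto
  moreover have "norm (r k - t) *\<^sub>R ?e k \<in> span (range ?e)"
    by (intro span_scaleR span_base) auto
  ultimately show ?thesis
    by (metis span_add)
qed

text \<open>Gram-Schmidt is applied to what remains of a dense sequence after projection. Zero
  entries of \<open>e\<close> are allowed because the complement may have finite dimension, possibly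
  0.\<close>

lemma orthonormal_complement_exists:
  assumes u: "orthonormal_system ip u" and sep: "separable_space (euclidean :: 'a topology)"
  obtains e :: "nat \<Rightarrow> 'a" where "\<And>i j. ip (e i) (e j) = (if i = j \<and> e i \<noteq> 0 then 1 else 0)"
    "\<And>i n. ip (e i) (u n) = 0"
    "closure (span (range u \<union> range e)) = UNIV"
proof -
  obtain D :: "'a set" where D: "countable D" "closure D = UNIV"
    using sep by (auto simp: separable_space_def)
  then have "D \<noteq> {}"
    by auto
  define d where "d = from_nat_into D"
  have range_d: "range d = D"
    unfolding d_def using D \<open>D \<noteq> {}\<close> by simp
  have "\<exists>p. p \<in> closure (span (range u)) \<and> (\<forall>n. ip (d k - p) (u n) = 0)" for k
    using orthogonal_projection_exists[OF u] by metis
  then obtain p where p: "\<And>k. p k \<in> closure (span (range u))" "\<And>k n. ip (d k - p k) (u n) = 0"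
    by metis
  define e where "e = gram_schmidt (\<lambda>k. d k - p k)"
  let ?S = "span (range u \<union> range e)"
  have "d k \<in> closure ?S" for k
  proof -
    obtain x where x: "\<And>n. x n \<in> span (range u)" "x \<longlonglongrightarrow> p k"
      using p(1) unfolding closure_sequential by blast
    have "d k - p k \<in> ?S"
      using in_span_gram_schmidt[of "\<lambda>k. d k - p k" k] span_mono[of "range e" "range u \<union> range e"]
      by (auto simp: e_def)
    moreover have "x n \<in> ?S" for n
      using x(1) span_mono[of "range u" "range u \<union> range e"] by auto
    ultimately have "x n + (d k - p k) \<in> ?S" for n
      by (simp add: span_add)
    moreover have "(\<lambda>n. x n + (d k - p k)) \<longlonglongrightarrow> d k"
      using tendsto_add[OF x(2) tendsto_const[of "d k - p k"]] by simp
    ultimately show ?thesis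
      unfolding closure_sequential by (intro exI[of _ "\<lambda>n. x n + (d k - p k)"]) auto
  qed
  then have "D \<subseteq> closure ?S"
    using range_d by auto
  then have "closure ?S = UNIV"
    using D(2) closure_minimal[of D "closure ?S"] by auto
  moreover have "ip (e i) (u n) = 0" for i n
    unfolding e_def by (intro ip_gram_schmidt_eq_0 p(2))
  ultimately show ?thesis
    using that[of e] ip_gram_schmidt by (auto simp: e_def)
qed

end

section \<open>Absorbing the complement block by block\<close>

text \<open>Block \<open>j\<close> absorbs \<open>absorbed e w j\<close> and releases \<open>absorbed e w (2 * j + 1)\<close>.  Even blocks absorb
  the basis of the complement, and \<open>j \<mapsto> 2 * j + 1\<close> hands every released vector to exactly one odd
  block.  A block that absorbs \<open>0\<close> is left unchanged and releases \<open>0\<close>.\<close>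

function absorbed :: "(nat \<Rightarrow> 'a::zero) \<Rightarrow> (nat \<Rightarrow> 'a) \<Rightarrow> nat \<Rightarrow> 'a" where
  "absorbed e w j =
    (if even j then e (j div 2) else if absorbed e w (j div 2) = 0 then 0 else w (j div 2))"
  by pat_completeness auto
termination
  by (relation "Wellfounded.measure (\<lambda>(e, w, j). j)") (simp_all add: odd_pos)

declare absorbed.simps [simp del]

lemma absorbed_even: "absorbed e w (2 * j) = e j"
  by (subst absorbed.simps) simp

lemma absorbed_odd: "absorbed e w (Suc (2 * j)) = (if absorbed e w j = 0 then 0 else w j)"
  by (subst absorbed.simps) simp

text \<open>\<open>b n\<close> is the block of index \<open>n\<close>: the pairs
  \<open>(j, i)\<close> with \<open>i < N j\<close> are enumerated, and \<open>b\<close> reads off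
  the first component. Positive sizes make the set of pairs infinite, so the enumeration is a
  bijection from \<open>nat\<close>.\<close>

lemma blocks_exist:
  fixes N :: "nat \<Rightarrow> nat"
  assumes "\<And>j. N j > 0"
  obtains b :: "nat \<Rightarrow> nat" where "\<And>j. finite (b -` {j})" "\<And>j. card (b -` {j}) = N j"
proof -
  define S where "S = (SIGMA j:UNIV. {..<N j})"
  have "range (\<lambda>j. (j, 0)) \<subseteq> S"
    using assms by (auto simp: S_def)
  moreover have "infinite (range (\<lambda>j::nat. (j, 0::nat)))"
    by (intro range_inj_infinite injI) simp
  ultimately have "infinite S"
    using finite_subset by blast
  then have bij: "bij_betw (from_nat_into S) UNIV S"
    by (intro bij_betw_from_nat_into) auto
  have block: "bij_betw (from_nat_into S) ((fst \<circ> from_nat_into S) -` {j}) ({j} \<times> {..<N j})" for j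
  proof (rule bij_betw_subset[OF bij])
    show "from_nat_into S ` ((fst \<circ> from_nat_into S) -` {j}) = {j} \<times> {..<N j}"
    proof -
      have "from_nat_into S ` ((fst \<circ> from_nat_into S) -` {j}) = {x \<in> S. fst x = j}"
        using bij by (force simp: bij_betw_def)
      also have "\<dots> = {j} \<times> {..<N j}"
        by (auto simp: S_def)
      finally show ?thesis .
    qed
  qed simp
  show ?thesis
  proof (rule that)
    show "finite ((fst \<circ> from_nat_into S) -` {j})" for j
      using bij_betw_finite[OF block[of j]] by simp
    show "card ((fst \<circ> from_nat_into S) -` {j}) = N j" for j
      using bij_betw_same_card[OF block[of j]] by simp
  qed
qed

text \<open>Only finitely many indices lie in the blocks below \<open>k\<close>. This transfers
  decay in the block number to decay in \<open>n\<close>.\<close>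

lemma filterlim_at_top_if_finite_fibres:
  fixes b :: "nat \<Rightarrow> nat"
  assumes "\<And>j. finite (b -` {j})"
  shows "filterlim b at_top sequentially"
  unfolding filterlim_at_top
proof
  fix k
  have "{n. \<not> k \<le> b n} = (\<Union>j<k. b -` {j})"
    by auto
  then have "finite {n. \<not> k \<le> b n}"
    by (elim ssubst) (intro finite_UN_I finite_lessThan assms)
  then show "\<forall>\<^sub>F n in sequentially. k \<le> b n"
    unfolding cofinite_eq_sequentially[symmetric] eventually_cofinite .
qed

section \<open>The perturbed system for a given partition into blocks\<close>

context hilbert_space
begin

text \<open>The condition on \<open>c\<close> makes every block nonempty and \<open>c j\<close> the
  inverse square root of its size, so that the sum over block \<open>j\<close> scaled by
  \<open>c j\<close> is a unit vector.\<close>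

lemma orthonormal_basis_near_orthonormal_system:
  fixes b :: "nat \<Rightarrow> nat" and c :: "nat \<Rightarrow> real"
  assumes u: "orthonormal_system ip u" and sep: "separable_space (euclidean :: 'a topology)"
    and fin: "\<And>j. finite (b -` {j})" and c_pos: "\<And>j. c j > 0"
    and c: "\<And>j. (c j)\<^sup>2 * real (card (b -` {j})) = 1"
  obtains v where "orthonormal_basis smul ip v" "\<And>n. norm (v n - u n) \<le> 2 * c (b n)"
proof -
  obtain e :: "nat \<Rightarrow> 'a" where ee: "\<And>i j. ip (e i) (e j) = (if i = j \<and> e i \<noteq> 0 then 1 else 0)"
    and eu: "\<And>i n. ip (e i) (u n) = 0" and dense: "closure (span (range u \<union> range e)) = UNIV"
    using orthonormal_complement_exists[OF u sep] by blast
  have uu: "ip (u n) (u m) = (if n = m then 1 else 0)" for n m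
    using u by (simp add: orthonormal_system_def)
  define w where "w j = c j *\<^sub>R (\<Sum>n\<in>b -` {j}. u n)" for j
  define g where "g = absorbed e w"
  have g_even: "g (2 * j) = e j" and g_odd: "g (Suc (2 * j)) = (if g j = 0 then 0 else w j)" for j
    by (simp_all add: g_def absorbed_even absorbed_odd)
  have uw: "ip (u n) (w j) = (if b n = j then of_real (c j) else 0)" for n j
    using fin[of j] by (simp add: w_def ip_scaleR_right ip_sum_right uu)
  have ew: "ip (e i) (w j) = 0" for i j
    by (simp add: w_def ip_scaleR_right ip_sum_right eu)
  have ww: "ip (w i) (w j) = (if i = j then 1 else 0)" for i j
  proof -
    have "ip (w i) (w j) = of_real (c i) * (\<Sum>n\<in>b -` {i}. if i = j then of_real (c j) else 0)"
      unfolding w_def[of i] ip_scaleR_left ip_sum_left by (simp add: uw)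
    also have "\<dots> = (if i = j then of_real ((c i)\<^sup>2 * real (card (b -` {i}))) else 0)"
      by (simp add: power2_eq_square)
    finally show ?thesis
      by (simp add: c)
  qed
  have w_nz: "w j \<noteq> 0" for j
    using ww[of j j] by auto
  \<comment> \<open>A block releases a nonzero vector exactly when it absorbs one, so its
    displacement is either zero or a difference of two orthonormal vectors.\<close>
  have g_odd_nz: "g (Suc (2 * j)) = 0 \<longleftrightarrow> g j = 0" for j
    by (simp add: g_odd w_nz)
  have gg: "ip (g i) (g j) = (if i = j \<and> g i \<noteq> 0 then 1 else 0)" for i j
  proof -
    have we: "ip (w i) (e j) = 0" for i j
      using ew ip_eq_0_commute by blast
    have "i = 2 * (i div 2) \<or> i = Suc (2 * (i div 2))" "j = 2 * (j div 2) \<or> j = Suc (2 * (j div 2))"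
      by presburger+
    then obtain i' j' where "i = 2 * i' \<or> i = Suc (2 * i')" "j = 2 * j' \<or> j = Suc (2 * j')"
      by blast
    moreover have "2 * i' \<noteq> Suc (2 * j')" "Suc (2 * i') \<noteq> 2 * j'"
      by presburger+
    ultimately show ?thesis
      by (elim disjE) (auto simp: g_even g_odd ee ew we ww w_nz)
  qed
  have ug: "ip (u n) (g j) = (if j = Suc (2 * b n) \<and> g j \<noteq> 0 then of_real (c (b n)) else 0)" for n j
  proof (cases "even j")
    case True
    then obtain k where "j = 2 * k" by blast
    moreover have "2 * k \<noteq> Suc (2 * b n)" by presburger
    ultimately show ?thesis
      using eu ip_eq_0_commute by (auto simp: g_even)
  next
    case False
    then obtain k where "j = Suc (2 * k)" by (metis oddE Suc_eq_plus1)
    then show ?thesis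
      by (auto simp: g_odd uw w_nz)
  qed
  have gu: "ip (g j) (u n) = (if j = Suc (2 * b n) \<and> g j \<noteq> 0 then of_real (c (b n)) else 0)" for n j
    using ug[of n j] ip_commute[of "g j" "u n"] by (simp add: conj_of_real)
  define v where "v n = u n + c (b n) *\<^sub>R (g (b n) - g (Suc (2 * b n)))" for n
  \<comment> \<open>Within an active block the two mixed terms give
    \<open>- 2 * (c j)\<^sup>2\<close>, cancelling the squared norm of the displacement. If one
    block absorbs what the other releases, a mixed term and the product of the displacements cancel.
    Otherwise these terms vanish.\<close>
  have "ip (v n) (v m) = (if n = m then 1 else 0)" for n m
    unfolding v_def
    by (auto simp: ip_add_left ip_add_right ip_diff_left ip_diff_right ip_scaleR_left ip_scaleR_right
        uu ug gu gg g_odd_nz)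
  then have v: "orthonormal_system ip v"
    by (simp add: orthonormal_system_def)
  have gv: "g j \<in> span (range v)" for j
  proof (cases "g j = 0")
    case False
    \<comment> \<open>The displacement is constant on the block and enters with total weight 1; its
      part \<open>- w j\<close> cancels the sum of the \<open>u n\<close>, leaving the absorbed
      vector.\<close>
    have "c j *\<^sub>R (\<Sum>n\<in>b -` {j}. v n)
        = w j + c j *\<^sub>R (\<Sum>n\<in>b -` {j}. c j *\<^sub>R (g j - g (Suc (2 * j))))"
      by (simp add: v_def w_def sum.distrib scaleR_add_right)
    also have "\<dots> = w j + ((c j)\<^sup>2 * real (card (b -` {j}))) *\<^sub>R (g j - g (Suc (2 * j)))"
      by (simp add: sum_constant_scaleR power2_eq_square mult_ac)
    also have "\<dots> = g j"
      using False by (simp add: c g_odd)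
    finally have "g j = c j *\<^sub>R (\<Sum>n\<in>b -` {j}. v n)"
      by (rule sym)
    then show ?thesis
      by (elim ssubst) (intro span_scaleR span_sum span_base rangeI)
  qed (simp add: span_zero)
  have "u n \<in> span (range v)" for n
  proof -
    have "v n - c (b n) *\<^sub>R (g (b n) - g (Suc (2 * b n))) \<in> span (range v)"
      by (intro span_diff span_scaleR span_base rangeI gv)
    then show ?thesis
      by (simp add: v_def)
  qed
  moreover have "e n \<in> span (range v)" for n
    using gv[of "2 * n"] by (simp add: g_even)
  ultimately have "span (range u \<union> range e) \<subseteq> span (range v)"
    by (intro span_minimal subspace_span) auto
  then have "closure (span (range v)) = UNIV"
    using dense closure_mono by blast
  with v have "orthonormal_basis smul ip v"
    by (simp add: orthonormal_basis_def)
  moreover have "norm (v n - u n) \<le> 2 * c (b n)" for n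
  proof -
    have norm_g: "norm (g j) \<le> 1" for j
      using gg[of j j] norm_eq_1_if_ip_self[of "g j"] by (cases "g j = 0") auto
    have "norm (g (b n) - g (Suc (2 * b n))) \<le> 1 + 1"
      by (rule order_trans[OF norm_triangle_ineq4 add_mono[OF norm_g norm_g]])
    then show ?thesis
      using c_pos[of "b n"] by (simp add: v_def)
  qed
  ultimately show ?thesis
    using that by blast
qed

end

theorem mainTheorem1:
  fixes smul :: "'k::real_or_complex_field \<Rightarrow> 'a::{real_normed_vector, complete_space} \<Rightarrow> 'a"
    and ip :: "'a \<Rightarrow> 'a \<Rightarrow> 'k"
    and \<phi> :: "nat \<Rightarrow> 'a"
    and \<epsilon> :: real
  assumes "hilbert_space smul ip"
    and "separable_space (euclidean :: 'a topology)"
    and "orthonormal_system ip \<phi>"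
    and "\<epsilon> > 0"
  shows "\<exists>\<psi>. orthonormal_basis smul ip \<psi> \<and>
    (\<lambda>n. norm (\<psi> n - \<phi> n)) \<longlonglongrightarrow> 0 \<and>
    (\<forall>n. norm (\<psi> n - \<phi> n) < \<epsilon>)"
proof -
  interpret hilbert_space smul ip by fact
  \<comment> \<open>Blocks of size \<open>K + j\<close> move vectors by at most
    \<open>2 / sqrt (K + j)\<close>: the offset \<open>K\<close> keeps this below \<epsilon> for
    every \<open>j\<close>, and the growth in \<open>j\<close> gives the limit.\<close>
  obtain K :: nat where K: "real K > 4 / \<epsilon>\<^sup>2"
    using reals_Archimedean2 by blast
  then have "real K > 0"
    using order_le_less_trans[of 0 "4 / \<epsilon>\<^sup>2" "real K"] by simp
  define c where "c j = 1 / sqrt (real (K + j))" for j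
  obtain b :: "nat \<Rightarrow> nat" where b: "\<And>j. finite (b -` {j})" "\<And>j. card (b -` {j}) = K + j"
    by (rule blocks_exist[of "\<lambda>j. K + j"]) (use \<open>real K > 0\<close> in auto)
  have c_pos: "c j > 0" and c2: "(c j)\<^sup>2 = 1 / real (K + j)" for j
    using \<open>real K > 0\<close> by (simp_all add: c_def power_divide)
  then have c_square: "(c j)\<^sup>2 * real (card (b -` {j})) = 1" for j
    using \<open>real K > 0\<close> by (simp add: b)
  obtain \<psi> where \<psi>: "orthonormal_basis smul ip \<psi>" "\<And>n. norm (\<psi> n - \<phi> n) \<le> 2 * c (b n)"
    by (rule orthonormal_basis_near_orthonormal_system[OF assms(3,2) b(1) c_pos c_square]) (rule that)
  have "2 * c j < \<epsilon>" for j
  proof (rule power2_less_imp_less)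
    have "4 < real K * \<epsilon>\<^sup>2"
      using K \<open>\<epsilon> > 0\<close> by (simp add: field_simps)
    also have "\<dots> \<le> real (K + j) * \<epsilon>\<^sup>2"
      by (intro mult_right_mono) auto
    finally have "4 / real (K + j) < \<epsilon>\<^sup>2"
      using \<open>real K > 0\<close> by (simp add: pos_divide_less_eq mult.commute)
    then show "(2 * c j)\<^sup>2 < \<epsilon>\<^sup>2"
      by (simp add: c2 power_mult_distrib)
  qed (use \<open>\<epsilon> > 0\<close> in simp)
  then have "\<forall>n. norm (\<psi> n - \<phi> n) < \<epsilon>"
    using \<psi>(2) order_le_less_trans by blast
  moreover have "(\<lambda>n. norm (\<psi> n - \<phi> n)) \<longlonglongrightarrow> 0"
  proof (rule tendsto_sandwich[OF _ _ tendsto_const])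
    have "filterlim (\<lambda>j. K + j) at_top sequentially"
      by (rule filterlim_at_top_mono[OF filterlim_ident]) simp
    then have "filterlim (\<lambda>j. sqrt (real (K + j))) at_top sequentially"
      by (intro filterlim_compose[OF sqrt_at_top] filterlim_compose[OF filterlim_real_sequentially])
    then have "c \<longlonglongrightarrow> 0"
      unfolding c_def by (intro tendsto_divide_0[OF tendsto_const] filterlim_at_top_imp_at_infinity)
    then have "(\<lambda>j. 2 * c j) \<longlonglongrightarrow> 0"
      by (rule tendsto_mult_right_zero)
    then show "(\<lambda>n. 2 * c (b n)) \<longlonglongrightarrow> 0"
      by (rule filterlim_compose[OF _ filterlim_at_top_if_finite_fibres[OF b(1)]])
  qed (use \<psi>(2) in auto)
  ultimately show ?thesis
    using \<psi>(1) by blast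
qed

end
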